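(* Let $\sigma>0$, $\lambda>0$, $M\in\mathbb N$, $\vec k=(k_1,\dots,k_M)$ with all $k_j>0$. Then $\mathrm{ABEP}_{\mathsf L}(\sigma,\vec k,\lambda)$ has a reversible measure on $X_c$ with density with respect to Lebesgue measure given by $$\mu_{\mathsf L}(\vec x,\sigma,\vec k,\lambda)=\prod_{j=1}^M\sinh_\sigma\big(\lambda+2E_j^-(\vec x)\big)\frac{\Big(\cosh_\sigma\big(\lambda+2E_j^-(\vec x)\big)-\cosh_\sigma\big(\lambda+2E_{j-1}^-(\vec x)\big)\Big)^{k_j-1}}{\sigma^{k_j-1}\Gamma(k_j)}.$$
   Context: $X_c=\mathbb R_{\ge0}^M$; $\sinh_\sigma(x)=\sinh(\sigma x)$, $\cosh_\sigma(x)=\cosh(\sigma x)$; $E_j^-(\vec x)=\sum_{i=1}^jx_i$, $E_0^-=0$. Reversibility of a measure with density $\mu$ means that the generator $L$ is symmetric: for all $f_1,f_2\in C^2(X_c)$ with compact support, $\int_{X_c}[Lf_1](\vec x)f_2(\vec x)\mu(\vec x)\,d\vec x=\int_{X_c}f_1(\vec x)[Lf_2](\vec x)\mu(\vec x)\,d\vec x$. $\mathrm{ABEP}_{\mathsf L}(\sigma,\vec k,\lambda)$ (dynamic ABEP, left version) is the diffusion on $X_c$ with generator $$[L^{\mathrm{ABEP}_{\mathsf L}}_{\sigma,\vec k,\lambda}f](\vec x)=\sum_{j=1}^{M-1}A_j\Big(\frac{\partial}{\partial x_j}-\frac{\partial}{\partial x_{j+1}}\Big)^2f(\vec x)+B_j\Big(\frac{\partial}{\partial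 x_j}-\frac{\partial}{\partial x_{j+1}}\Big)f(\vec x),$$ $$A_j=\frac1{\sigma^2}\sinh_\sigma(x_j)\sinh_\sigma(x_{j+1})\frac{\sinh_\sigma(\lambda+2E_j^--x_j)\sinh_\sigma(\lambda+2E_j^-+x_{j+1})}{\sinh_\sigma(\lambda+2E_j^-)^2},$$ $$B_j=\frac1\sigma\Big[k_j\sinh_\sigma(x_{j+1})\frac{\sinh_\sigma(\lambda+2E_j^-+x_{j+1})}{\sinh_\sigma(\lambda+2E_j^-)}-k_{j+1}\sinh_\sigma(x_j)\frac{\sinh_\sigma(\lambda+2E_j^--x_j)}{\sinh_\sigma(\lambda+2E_j^-)}$$ $$-2\sinh_\sigma(x_j)\sinh_\sigma(x_{j+1})\frac{\cosh_\sigma(\lambda+2E_j^-)\sinh_\sigma(\lambda+2E_j^--x_j)\sinh_\sigma(\lambda+2E_j^-+x_{j+1})}{\sinh_\sigma(\lambda+2E_j^-)^3}\Big].$$ *)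

theory Defs
  imports "HOL-Analysis.Analysis"
begin

(* The coordinates 1, ..., M are represented by a finite linearly ordered index type 'm with
   M = CARD('m). *)

definition X_c :: "(real ^ 'm) set" where
  "X_c = {x. \<forall>i. 0 \<le> x $ i}"

definition sinh_scaled :: "real \<Rightarrow> real \<Rightarrow> real" where
  "sinh_scaled \<sigma> x = sinh (\<sigma> * x)"

definition cosh_scaled :: "real \<Rightarrow> real \<Rightarrow> real" where
  "cosh_scaled \<sigma> x = cosh (\<sigma> * x)"

(* The index j + 1; meaningful only when j is not the last index. *)
definition next_index :: "'m::{finite,linorder} \<Rightarrow> 'm::{finite,linorder}" where
  "next_index j = Min {j<..}"

(* E_left x j is E_j^-(x) and E_left_pred x j is E_{j-1}^-(x); the latter is the empty sum for
   the first index. *)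
definition E_left :: "real ^ ('m::{finite,linorder}) \<Rightarrow> 'm::{finite,linorder} \<Rightarrow> real" where
  "E_left x j = (\<Sum>i\<in>{..j}. x $ i)"

definition E_left_pred :: "real ^ ('m::{finite,linorder}) \<Rightarrow> 'm::{finite,linorder} \<Rightarrow> real" where
  "E_left_pred x j = (\<Sum>i\<in>{..<j}. x $ i)"

(* Partial derivatives are taken within the closed orthant, hence one-sided at its boundary;
   derivatives within X_c are unique at every point of X_c and do not depend on the values of
   the function outside X_c. *)
definition partial :: "'m \<Rightarrow> (real ^ 'm \<Rightarrow> real) \<Rightarrow> real ^ 'm \<Rightarrow> real" where
  "partial i f x = frechet_derivative f (at x within X_c) (axis i 1)"

definition C1 :: "(real ^ 'm \<Rightarrow> real) \<Rightarrow> bool" where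
  "C1 f \<longleftrightarrow> f differentiable_on X_c \<and> (\<forall>i. continuous_on X_c (partial i f))"

definition C2 :: "(real ^ 'm \<Rightarrow> real) \<Rightarrow> bool" where
  "C2 f \<longleftrightarrow> C1 f \<and> (\<forall>i. C1 (partial i f))"

(* The support is taken relative to X_c and may meet the boundary of the orthant. *)
definition C2_compact_support :: "(real ^ 'm \<Rightarrow> real) set" where
  "C2_compact_support = {f. C2 f \<and> compact (closure {x \<in> X_c. f x \<noteq> 0})}"

(* The operator d/dx_j - d/dx_{j+1}. *)
definition D_exchange ::
    "'m::{finite,linorder} \<Rightarrow> (real ^ ('m::{finite,linorder}) \<Rightarrow> real) \<Rightarrow>
      real ^ ('m::{finite,linorder}) \<Rightarrow> real" where
  "D_exchange j f x = partial j f x - partial (next_index j) f x"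

definition A_left :: "real \<Rightarrow> real \<Rightarrow> 'm::{finite,linorder} \<Rightarrow>
      real ^ ('m::{finite,linorder}) \<Rightarrow> real" where
  "A_left \<sigma> lam j x =
    (let u = lam + 2 * E_left x j; y = x $ j; z = x $ next_index j in
      1 / \<sigma>\<^sup>2 * sinh_scaled \<sigma> y * sinh_scaled \<sigma> z *
        (sinh_scaled \<sigma> (u - y) * sinh_scaled \<sigma> (u + z) / (sinh_scaled \<sigma> u)\<^sup>2))"

definition B_left ::
    "real \<Rightarrow> real ^ ('m::{finite,linorder}) \<Rightarrow> real \<Rightarrow> 'm::{finite,linorder} \<Rightarrow>
      real ^ ('m::{finite,linorder}) \<Rightarrow> real" where
  "B_left \<sigma> k lam j x =
    (let u = lam + 2 * E_left x j; y = x $ j; z = x $ next_index j in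
      1 / \<sigma> *
       (k $ j * sinh_scaled \<sigma> z * (sinh_scaled \<sigma> (u + z) / sinh_scaled \<sigma> u)
        - k $ next_index j * sinh_scaled \<sigma> y * (sinh_scaled \<sigma> (u - y) / sinh_scaled \<sigma> u)
        - 2 * sinh_scaled \<sigma> y * sinh_scaled \<sigma> z *
          (cosh_scaled \<sigma> u * sinh_scaled \<sigma> (u - y) * sinh_scaled \<sigma> (u + z)
            / (sinh_scaled \<sigma> u) ^ 3)))"

(* The generator; the sum runs over all indices but the last one. *)
definition L_ABEP_left ::
    "real \<Rightarrow> real ^ ('m::{finite,linorder}) \<Rightarrow> real \<Rightarrow> (real ^ ('m::{finite,linorder}) \<Rightarrow> real) \<Rightarrow>
      real ^ ('m::{finite,linorder}) \<Rightarrow> real" where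
  "L_ABEP_left \<sigma> k lam f x =
    (\<Sum>j | j \<noteq> Max UNIV.
       A_left \<sigma> lam j x * D_exchange j (D_exchange j f) x
       + B_left \<sigma> k lam j x * D_exchange j f x)"

(* Symmetry of the generator with respect to the measure on X_c with Lebesgue density mu.
   The Bochner integral of a non-integrable function is 0 by convention, so the existence of
   both integrals is required explicitly; likewise that mu is the density of a measure. *)
definition reversible_density ::
    "((real ^ 'm \<Rightarrow> real) \<Rightarrow> real ^ 'm \<Rightarrow> real) \<Rightarrow> (real ^ 'm \<Rightarrow> real) \<Rightarrow> bool" where
  "reversible_density L \<mu> \<longleftrightarrow>
     set_borel_measurable lborel X_c \<mu> \<and> (\<forall>x\<in>X_c. 0 \<le> \<mu> x) \<and>
     (\<forall>f1\<in>C2_compact_support. \<forall>f2\<in>C2_compact_support.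
        set_integrable lborel X_c (\<lambda>x. L f1 x * f2 x * \<mu> x) \<and>
        set_integrable lborel X_c (\<lambda>x. f1 x * L f2 x * \<mu> x) \<and>
        (LINT x:X_c|lborel. L f1 x * f2 x * \<mu> x) = (LINT x:X_c|lborel. f1 x * L f2 x * \<mu> x))"

(* On the Lebesgue-null set where some x_j = 0 the base of powr is 0 and 0 powr a = 0, also for
   negative a. *)
definition mu_left ::
    "real \<Rightarrow> real ^ ('m::{finite,linorder}) \<Rightarrow> real \<Rightarrow> real ^ ('m::{finite,linorder}) \<Rightarrow> real" where
  "mu_left \<sigma> k lam x =
    (\<Prod>j\<in>UNIV.
       sinh_scaled \<sigma> (lam + 2 * E_left x j) *
       ((cosh_scaled \<sigma> (lam + 2 * E_left x j) - cosh_scaled \<sigma> (lam + 2 * E_left_pred x j))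
          powr (k $ j - 1)
        / (\<sigma> powr (k $ j - 1) * Gamma (k $ j))))"

end

(* Put c_j = cosh(sigma (lambda + 2 E_j)). Along the direction e_j - e_(j+1) only E_j varies, and in
   the variable c_j the density is a Beta weight (c_j - c_(j-1))^(k_j - 1) (c_(j+1) - c_j)^(k_(j+1) - 1)
   times sinh(sigma (lambda + 2 E_j)) and a constant. The j-th summand of the generator is the Jacobi
   operator of that weight, so D_j (A_j mu) = B_j mu. With h = f2 D_j f1 - f1 D_j f2 the integrand
   of the antisymmetric part is D_j (A_j mu h), a directional derivative of a function that vanishes at
   both ends of every exchange line. Its integral is 0 by Fubini and translation invariance of Lebesgue
   measure: the integral of DF equals that of F(x + v) - F(x), so no change of coordinates is needed. *)

theory Submission
  imports Defs
begin

section \<open>Translation invariance and integrals of directional derivatives\<close>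

lemma integrable_lborel_translation:
  fixes G :: "'a::euclidean_space \<Rightarrow> real"
  shows "integrable lborel (\<lambda>x. G (x + c)) \<longleftrightarrow> integrable lborel G"
proof -
  have imp: "integrable lborel (\<lambda>x. H (x + d))" if "integrable lborel H" for H :: "'a \<Rightarrow> real" and d
  proof -
    have "integrable (distr lborel borel ((+) d)) H"
      using that by (simp add: lborel_distr_plus)
    then have "integrable lborel (\<lambda>x. H (d + x))"
      by (rule integrable_distr[rotated]) simp
    then show ?thesis by (simp add: add.commute)
  qed
  show ?thesis
    using imp[of G c] imp[of "\<lambda>x. G (x + c)" "-c"] by (auto simp: algebra_simps)
qed

lemma integral_lborel_translation:
  fixes G :: "'a::euclidean_space \<Rightarrow> real"
  assumes "G \<in> borel_measurable borel"
  shows "(LINT x|lborel. G (x + c)) = (LINT x|lborel. G x)"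
proof -
  have "(LINT x|lborel. G x) = (LINT x|distr lborel borel ((+) c). G x)"
    by (simp add: lborel_distr_plus)
  also have "\<dots> = (LINT x|lborel. G (c + x))"
    using assms by (subst integral_distr) auto
  finally show ?thesis by (simp add: add.commute)
qed

text \<open>Integrate \<open>G (x + s *\<^sub>R v)\<close> over all \<open>x\<close> and over
  \<open>s\<close> in \<open>{0..1}\<close>. Taking \<open>x\<close> first gives the integral of
  \<open>G\<close>, by translation invariance; taking \<open>s\<close> first gives that of
  \<open>F (x + v) - F x\<close>, which is 0. The finite set \<open>S\<close> leaves room for points
  where \<open>F\<close> is not differentiable, such as those where a line enters or leaves the
  orthant.\<close>

lemma integral_directional_derivative_eq_0:
  fixes F G :: "'a::euclidean_space \<Rightarrow> real"
  assumes F: "integrable lborel F" and G: "integrable lborel G"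
    and cont: "\<And>x. continuous_on {0..1} (\<lambda>s. F (x + s *\<^sub>R v))"
    and deriv: "\<And>x. \<exists>S. finite S \<and>
      (\<forall>s. s \<notin> S \<longrightarrow> ((\<lambda>s. F (x + s *\<^sub>R v)) has_real_derivative G (x + s *\<^sub>R v)) (at s))"
  shows "(LINT x|lborel. G x) = 0"
proof -
  define H :: "real \<Rightarrow> 'a \<Rightarrow> real" where "H s x = indicator {0..1} s * G (x + s *\<^sub>R v)" for s x
  have Gm [measurable]: "G \<in> borel_measurable borel" and Fm [measurable]: "F \<in> borel_measurable borel"
    using F G by auto
  have Hint: "integrable (lborel \<Otimes>\<^sub>M lborel) (case_prod H)"
  proof (rule lborel_pair.Fubini_integrable)
    show "case_prod H \<in> borel_measurable (lborel \<Otimes>\<^sub>M lborel)"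
      unfolding H_def by measurable
    have "(LINT x|lborel. norm (H s x)) = indicator {0..1} s * (LINT x|lborel. norm (G x))" for s
      unfolding H_def using integral_lborel_translation[of "\<lambda>x. norm (G x)" "s *\<^sub>R v"]
      by (simp add: abs_mult)
    then show "integrable lborel (\<lambda>s. LINT x|lborel. norm (case_prod H (s, x)))"
      by simp
    show "AE s in lborel. integrable lborel (\<lambda>x. case_prod H (s, x))"
      unfolding H_def using G by (auto simp: integrable_lborel_translation)
  qed
  have "(LINT x|lborel. LINT s|lborel. H s x) = (LINT s|lborel. LINT x|lborel. H s x)"
    using Hint by (rule lborel_pair.Fubini_integral)
  also have "\<dots> = (LINT s|lborel. indicator {0..1::real} s * (LINT x|lborel. G x))"
    unfolding H_def using integral_lborel_translation[of G] by simp
  also have "\<dots> = (LINT x|lborel. G x)"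
    by simp
  finally have eq: "(LINT x|lborel. G x) = (LINT x|lborel. LINT s|lborel. H s x)" by simp
  \<comment> \<open>Fubini gives Lebesgue integrable slices only for almost every \<open>x\<close>;
    on these the gauge integral of the fundamental theorem is the Lebesgue integral.\<close>
  have "AE x in lborel. (LINT s|lborel. H s x) = F (x + v) - F x"
    using lborel_pair.AE_integrable_snd[OF Hint]
  proof eventually_elim
    case (elim x)
    obtain S where "finite S"
      and S: "\<And>s. s \<notin> S \<Longrightarrow> ((\<lambda>s. F (x + s *\<^sub>R v)) has_real_derivative G (x + s *\<^sub>R v)) (at s)"
      using deriv[of x] by blast
    have "((\<lambda>s. G (x + s *\<^sub>R v)) has_integral (F (x + 1 *\<^sub>R v) - F (x + 0 *\<^sub>R v))) {0..1}"
    proof (rule fundamental_theorem_of_calculus_strong[OF \<open>finite S\<close> _ _ cont[of x]])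
      fix s assume "s \<in> {0..1} - S"
      then show "((\<lambda>s. F (x + s *\<^sub>R v)) has_vector_derivative G (x + s *\<^sub>R v)) (at s)"
        unfolding has_real_derivative_iff_has_vector_derivative[symmetric] by (intro S) simp
    qed simp
    then have "integral {0..1} (\<lambda>s. G (x + s *\<^sub>R v)) = F (x + v) - F x"
      by (simp add: integral_unique)
    moreover have "set_integrable lborel {0..1} (\<lambda>s. G (x + s *\<^sub>R v))"
      using elim by (simp add: set_integrable_def H_def)
    ultimately have "(LINT s:{0..1}|lborel. G (x + s *\<^sub>R v)) = F (x + v) - F x"
      using set_borel_integral_eq_integral(2) by metis
    then show ?case by (simp add: set_lebesgue_integral_def H_def)
  qed
  then have "(LINT x|lborel. LINT s|lborel. H s x) = (LINT x|lborel. F (x + v) - F x)"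
    using lborel_pair.integrable_snd[OF Hint] by (intro integral_cong_AE) auto
  also have "\<dots> = 0"
    using F by (simp add: integrable_lborel_translation integral_lborel_translation)
  finally show ?thesis using eq by simp
qed

section \<open>Partial derivatives within the closed orthant\<close>

text \<open>From any point of \<open>X_c\<close> a small step in each positive coordinate direction
  stays in \<open>X_c\<close>. These steps already determine the derivative, so it is unique on the
  boundary too.\<close>

lemma partial_eqI:
  assumes x: "x \<in> X_c" and f: "(f has_derivative f') (at x within X_c)"
  shows "partial i f x = f' (axis i 1)"
proof -
  have "frechet_derivative f (at x within X_c) = f'"
  proof (rule frechet_derivative_unique_within[OF _ f])
    show "(f has_derivative frechet_derivative f (at x within X_c)) (at x within X_c)"
      using f frechet_derivative_works differentiableI by blast
    fix b :: "real ^ 'a" and e :: real assume "b \<in> Basis" "0 < e"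
    then show "\<exists>d. 0 < \<bar>d\<bar> \<and> \<bar>d\<bar> < e \<and> x + d *\<^sub>R b \<in> X_c"
      using x by (intro exI[of _ "e / 2"]) (auto simp: X_c_def Basis_vec_def axis_def)
  qed
  then show ?thesis by (simp add: partial_def)
qed

lemma partial_diff:
  assumes "x \<in> X_c" "f differentiable (at x within X_c)" "g differentiable (at x within X_c)"
  shows "partial i (\<lambda>x. f x - g x) x = partial i f x - partial i g x"
proof -
  obtain f' g' where f': "(f has_derivative f') (at x within X_c)" "(g has_derivative g') (at x within X_c)"
    using assms by (auto simp: differentiable_def)
  show ?thesis
    using partial_eqI[OF assms(1) has_derivative_diff[OF f']] partial_eqI[OF assms(1) f'(1)]
      partial_eqI[OF assms(1) f'(2)] by simp
qed

lemma C1_diff: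
  assumes "C1 f" "C1 g"
  shows "C1 (\<lambda>x. f x - g x)"
proof -
  have "continuous_on X_c (\<lambda>x. partial i f x - partial i g x)" for i
    using assms by (intro continuous_intros) (auto simp: C1_def)
  then have "continuous_on X_c (partial i (\<lambda>x. f x - g x))" for i
    using assms by (subst continuous_on_cong[OF refl partial_diff])
      (auto simp: C1_def differentiable_on_def)
  then show ?thesis using assms by (auto simp: C1_def)
qed

lemma partial_eq_0:
  assumes "x \<in> X_c" "closed K" "x \<notin> K" "\<And>y. y \<in> X_c - K \<Longrightarrow> f y = 0"
  shows "partial i f x = 0"
proof -
  obtain e where e: "0 < e" "ball x e \<subseteq> - K"
    using assms by (meson Compl_iff open_Compl open_contains_ball)
  have "(f has_derivative (\<lambda>_. 0)) (at x within X_c)"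
  proof (rule has_derivative_transform_within[OF has_derivative_const e(1) assms(1)])
    fix y assume "y \<in> X_c" "dist y x < e"
    then have "y \<in> X_c - K" using e(2) by (auto simp: dist_commute subset_iff)
    then show "0 = f y" using assms(4) by simp
  qed
  then show ?thesis using partial_eqI[OF assms(1)] by simp
qed

lemma C1_D_exchange: "C2 f \<Longrightarrow> C1 (D_exchange j f)"
  using C1_diff[of "partial j f" "partial (next_index j) f"]
  by (simp add: C2_def D_exchange_def[abs_def])

lemma continuous_on_D_exchange: "C1 f \<Longrightarrow> continuous_on X_c (D_exchange j f)"
  unfolding D_exchange_def by (intro continuous_intros) (auto simp: C1_def)

lemma D_exchange_eq_0:
  assumes "x \<in> X_c" "closed K" "x \<notin> K" "\<And>y. y \<in> X_c - K \<Longrightarrow> f y = 0"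
  shows "D_exchange j f x = 0"
  using partial_eq_0[OF assms] by (simp add: D_exchange_def)

abbreviation exchange_vec :: "'m::{finite,linorder} \<Rightarrow> real ^ ('m::{finite,linorder})" where
  "exchange_vec j \<equiv> axis j 1 - axis (next_index j) 1"

lemma D_exchange_eqI:
  assumes x: "x \<in> X_c" and f: "(f has_derivative f') (at x within X_c)"
  shows "D_exchange j f x = f' (exchange_vec j)"
  using partial_eqI[OF assms] has_derivative_bounded_linear[OF f]
  by (simp add: D_exchange_def linear_diff bounded_linear.linear)

text \<open>The line may run inside a face of the orthant, where \<open>f\<close> has only a
  derivative within \<open>X_c\<close>. The chain rule is applied within the open parameter
  interval, whose image lies in \<open>X_c\<close>; at a point of that interval the result is an
  ordinary derivative.\<close>

lemma has_real_derivative_along_exchange: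
  assumes f: "f differentiable_on X_c" and s: "a < s" "s < b"
    and line: "\<And>t. a \<le> t \<Longrightarrow> t \<le> b \<Longrightarrow> x + t *\<^sub>R exchange_vec j \<in> X_c"
  shows "((\<lambda>t. f (x + t *\<^sub>R exchange_vec j)) has_real_derivative
    D_exchange j f (x + s *\<^sub>R exchange_vec j)) (at s)"
proof -
  let ?l = "\<lambda>t. x + t *\<^sub>R exchange_vec j"
  have ls: "?l s \<in> X_c" using line s by auto
  then obtain f' where f': "(f has_derivative f') (at (?l s) within X_c)"
    using f unfolding differentiable_on_def differentiable_def by blast
  have l: "(?l has_derivative (\<lambda>t. t *\<^sub>R exchange_vec j)) (at s within {a<..<b})"
    by (auto intro!: derivative_eq_intros)
  have "?l ` {a<..<b} \<subseteq> X_c" using line by auto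
  then have "((\<lambda>t. f (?l t)) has_derivative (\<lambda>t. f' (t *\<^sub>R exchange_vec j))) (at s within {a<..<b})"
    using has_derivative_subset[OF f']
    by (intro has_derivative_in_compose[OF l]) auto
  then have "((\<lambda>t. f (?l t)) has_derivative (\<lambda>t. f' (t *\<^sub>R exchange_vec j))) (at s)"
    using s at_within_open[of s "{a<..<b}"] by simp
  moreover have "f' (t *\<^sub>R exchange_vec j) = D_exchange j f (?l s) * t" for t
    using D_exchange_eqI[OF ls f', of j] has_derivative_bounded_linear[OF f']
    by (simp add: linear_cmul bounded_linear.linear)
  ultimately show ?thesis
    by (simp add: has_field_derivative_def)
qed

section \<open>Partial sums and continuity of the coefficients\<close>

lemma E_left_eq_pred: "E_left x j = E_left_pred x j + x $ j"
proof -
  have "{..j} = insert j {..<j}" by auto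
  then show ?thesis by (simp add: E_left_def E_left_pred_def)
qed

lemma E_left_pred_nonneg: "x \<in> X_c \<Longrightarrow> 0 \<le> E_left_pred x j"
  by (auto simp: E_left_pred_def X_c_def intro: sum_nonneg)

lemma E_left_nonneg: "x \<in> X_c \<Longrightarrow> 0 \<le> E_left x j"
  by (auto simp: E_left_def X_c_def intro: sum_nonneg)

lemma continuous_on_E_left [continuous_intros]: "continuous_on S (\<lambda>x. E_left x j)"
  unfolding E_left_def by (intro continuous_intros)

lemma continuous_on_E_left_pred [continuous_intros]: "continuous_on S (\<lambda>x. E_left_pred x j)"
  unfolding E_left_pred_def by (intro continuous_intros)

lemma sinh_scaled_E_left_pos:
  assumes "0 < \<sigma>" "0 < lam" "x \<in> X_c"
  shows "0 < sinh_scaled \<sigma> (lam + 2 * E_left x j)"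
  using assms E_left_nonneg[of x j] by (simp add: sinh_scaled_def add_pos_nonneg)

lemma sinh_scaled_E_left_neq_0:
  assumes "0 < \<sigma>" "0 < lam" "x \<in> X_c"
  shows "sinh_scaled \<sigma> (lam + 2 * E_left x j) \<noteq> 0"
  using sinh_scaled_E_left_pos[OF assms, of j] by simp

lemma continuous_on_sinh_scaled [continuous_intros]:
  "continuous_on S f \<Longrightarrow> continuous_on S (\<lambda>x. sinh_scaled \<sigma> (f x))"
  unfolding sinh_scaled_def by (intro continuous_intros)

lemma continuous_on_cosh_scaled [continuous_intros]:
  "continuous_on S f \<Longrightarrow> continuous_on S (\<lambda>x. cosh_scaled \<sigma> (f x))"
  unfolding cosh_scaled_def by (intro continuous_intros)

lemma continuous_on_A_left:
  assumes "0 < \<sigma>" "0 < lam"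
  shows "continuous_on X_c (A_left \<sigma> lam j)"
  unfolding A_left_def Let_def using sinh_scaled_E_left_neq_0[OF assms]
  by (intro continuous_intros) auto

lemma continuous_on_B_left:
  assumes "0 < \<sigma>" "0 < lam"
  shows "continuous_on X_c (B_left \<sigma> k lam j)"
  unfolding B_left_def Let_def using sinh_scaled_E_left_neq_0[OF assms]
  by (intro continuous_intros) auto

section \<open>The density and its factors\<close>

definition mu_factor ::
    "real \<Rightarrow> real ^ ('m::{finite,linorder}) \<Rightarrow> real \<Rightarrow> 'm::{finite,linorder} \<Rightarrow>
      real ^ ('m::{finite,linorder}) \<Rightarrow> real" where
  "mu_factor \<sigma> k lam j x =
    sinh_scaled \<sigma> (lam + 2 * E_left x j) *
      ((cosh_scaled \<sigma> (lam + 2 * E_left x j) - cosh_scaled \<sigma> (lam + 2 * E_left_pred x j))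
          powr (k $ j - 1)
        / (\<sigma> powr (k $ j - 1) * Gamma (k $ j)))"

lemma mu_left_eq_prod: "mu_left \<sigma> k lam x = (\<Prod>j\<in>UNIV. mu_factor \<sigma> k lam j x)"
  by (simp add: mu_left_def mu_factor_def)

lemma mu_factor_nonneg:
  assumes "0 < \<sigma>" "0 < lam" "0 < k $ j" "x \<in> X_c"
  shows "0 \<le> mu_factor \<sigma> k lam j x"
  using sinh_scaled_E_left_pos[OF assms(1,2,4), of j] Gamma_real_pos[OF assms(3)]
  by (simp add: mu_factor_def)

lemma mu_left_nonneg:
  assumes "0 < \<sigma>" "0 < lam" "\<And>j. 0 < k $ j" "x \<in> X_c"
  shows "0 \<le> mu_left \<sigma> k lam x"
  using mu_factor_nonneg[OF assms(1,2) assms(3) assms(4)] by (auto simp: mu_left_eq_prod intro: prod_nonneg)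

lemma borel_measurable_mu_left [measurable]: "mu_left \<sigma> k lam \<in> borel_measurable borel"
proof -
  have [measurable]: "(\<lambda>x. sinh_scaled \<sigma> (lam + 2 * E_left x j)) \<in> borel_measurable borel"
    "(\<lambda>x. cosh_scaled \<sigma> (lam + 2 * E_left x j)) \<in> borel_measurable borel"
    "(\<lambda>x. cosh_scaled \<sigma> (lam + 2 * E_left_pred x j)) \<in> borel_measurable borel" for j :: 'a
    by (intro borel_measurable_continuous_onI continuous_intros)+
  show ?thesis unfolding mu_left_def by measurable
qed

lemma closed_X_c: "closed (X_c :: (real ^ 'm) set)"
proof -
  have "X_c = (\<Inter>i. {x :: real ^ 'm. 0 \<le> x $ i})" by (auto simp: X_c_def)
  also have "closed \<dots>" by (intro closed_INT ballI closed_Collect_le continuous_intros)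
  finally show ?thesis .
qed

section \<open>Integrability against the density\<close>

text \<open>By the mean value theorem the increment is \<open>t * sinh z\<close> with
  \<open>z\<close> between \<open>l\<close> and \<open>U\<close>. The sign of \<open>p\<close>
  decides which end bounds \<open>sinh z powr p\<close>; adding both values covers the two cases.
  For \<open>t = 0\<close> both sides are 0, since \<open>0 powr p = 0\<close>.\<close>

lemma cosh_diff_powr_le:
  fixes l r t U p :: real
  assumes "0 < l" "l \<le> r" "0 \<le> t" "r + t \<le> U"
  shows "(cosh (r + t) - cosh r) powr p \<le> t powr p * (sinh l powr p + sinh U powr p)"
proof (cases "t = 0")
  case False
  then have "0 < t" using assms by simp
  have "\<exists>z. r < z \<and> z < r + t \<and> cosh (r + t) - cosh r = (r + t - r) * sinh z"
    using \<open>0 < t\<close> by (intro MVT2) (auto intro!: derivative_eq_intros)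
  then obtain z where z: "r < z" "z < r + t" "cosh (r + t) - cosh r = t * sinh z" by auto
  have sz: "0 < sinh l" "sinh l \<le> sinh z" "sinh z \<le> sinh U" using z assms by auto
  have "sinh z powr p \<le> sinh l powr p + sinh U powr p"
  proof (cases "0 \<le> p")
    case True
    then have "sinh z powr p \<le> sinh U powr p" using sz by (intro powr_mono2) auto
    then show ?thesis by (simp add: add_increasing)
  next
    case False
    then have "sinh z powr p \<le> sinh l powr p" using sz by (intro powr_mono2') auto
    then show ?thesis by (simp add: add_increasing2)
  qed
  then have "t powr p * sinh z powr p \<le> t powr p * (sinh l powr p + sinh U powr p)"
    by (intro mult_left_mono) auto
  then show ?thesis
    using z sz \<open>0 < t\<close> by (simp add: powr_mult)
qed simp

text \<open>On a bounded box the factor can blow up only at the face \<open>x $ j = 0\<close>, and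
  there no faster than the stated power, because the cosh difference is \<open>x $ j\<close> times a
  quantity bounded away from 0 and from infinity.\<close>

lemma mu_factor_le:
  fixes k :: "real ^ 'm::{finite,linorder}"
  assumes "0 < \<sigma>" "0 < lam" "0 < k $ j"
  obtains C where "0 \<le> C"
    "\<And>x. x \<in> cbox 0 (vec R) \<Longrightarrow> mu_factor \<sigma> k lam j x \<le> C * (x $ j) powr (k $ j - 1)"
proof -
  \<comment> \<open>On the box \<open>U\<close> bounds the argument
    \<open>\<sigma> * (lam + 2 * E_left x j)\<close>: the sum has at most \<open>CARD('m)\<close>
    terms, each at most \<open>R\<close>.\<close>
  define U where "U = \<sigma> * (lam + 2 * (real CARD('m) * R))"
  define p where "p = k $ j - 1"
  define N where "N = \<sigma> powr p * Gamma (k $ j)"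
  have N: "0 < N" using assms Gamma_real_pos[of "k $ j"] by (simp add: N_def)
  define C where "C = sinh U * ((2 * \<sigma>) powr p * (sinh (\<sigma> * lam) powr p + sinh U powr p) / N)"
  have bound: "mu_factor \<sigma> k lam j x \<le> C * (x $ j) powr p" if x: "x \<in> cbox 0 (vec R)" for x
  proof -
    have xX: "x \<in> X_c" and xR: "x $ i \<le> R" and x0: "0 \<le> x $ i" for i
      using x by (auto simp: X_c_def mem_box_cart)
    have "0 \<le> R" using xR x0 order_trans by blast
    have "E_left x j \<le> (\<Sum>i\<in>{..j}. R)" unfolding E_left_def using xR by (intro sum_mono) auto
    also have "\<dots> \<le> real CARD('m) * R"
      using \<open>0 \<le> R\<close> by (auto intro!: mult_right_mono card_mono)
    finally have E: "E_left x j \<le> real CARD('m) * R" .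
    have u: "0 \<le> \<sigma> * (lam + 2 * E_left x j)" "\<sigma> * (lam + 2 * E_left x j) \<le> U"
      using E assms E_left_nonneg[OF xX, of j] by (auto simp: U_def)
    have S: "0 \<le> sinh_scaled \<sigma> (lam + 2 * E_left x j)" "sinh_scaled \<sigma> (lam + 2 * E_left x j) \<le> sinh U"
      using u by (auto simp: sinh_scaled_def)
    \<comment> \<open>The mean value estimate is used with \<open>l = \<sigma> * lam\<close>. The
      argument \<open>?r\<close> is at least that, and adding \<open>?t\<close> leads from
      \<open>E_left_pred x j\<close> to \<open>E_left x j\<close>.\<close>
    let ?r = "\<sigma> * (lam + 2 * E_left_pred x j)" and ?t = "2 * \<sigma> * x $ j"
    have rt: "?r + ?t = \<sigma> * (lam + 2 * E_left x j)" by (simp add: E_left_eq_pred algebra_simps)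
    have "(cosh (?r + ?t) - cosh ?r) powr p \<le> ?t powr p * (sinh (\<sigma> * lam) powr p + sinh U powr p)"
      using assms x0[of j] u E_left_pred_nonneg[OF xX, of j] unfolding rt[symmetric]
      by (intro cosh_diff_powr_le) auto
    then have c: "(cosh_scaled \<sigma> (lam + 2 * E_left x j) - cosh_scaled \<sigma> (lam + 2 * E_left_pred x j)) powr p
        \<le> (2 * \<sigma>) powr p * (x $ j) powr p * (sinh (\<sigma> * lam) powr p + sinh U powr p)"
      using assms x0[of j] unfolding rt by (simp add: cosh_scaled_def powr_mult)
    have "mu_factor \<sigma> k lam j x \<le> sinh U *
        ((2 * \<sigma>) powr p * (x $ j) powr p * (sinh (\<sigma> * lam) powr p + sinh U powr p) / N)"
      unfolding mu_factor_def p_def[symmetric] N_def[symmetric]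
      using S c N order_trans[OF u] by (intro mult_mono divide_right_mono) auto
    then show ?thesis by (simp add: C_def mult_ac)
  qed
  \<comment> \<open>For negative \<open>R\<close> the number \<open>sinh U\<close>, hence
    \<open>C\<close>, may be negative; the box is then empty and the constant 0 will do.\<close>
  have "0 \<le> C \<or> \<not> 0 \<le> R"
    using assms N by (auto simp: C_def U_def)
  then show ?thesis
  proof
    assume "0 \<le> C" then show ?thesis using that bound by (auto simp: p_def)
  next
    assume "\<not> 0 \<le> R"
    then have "x \<notin> cbox 0 (vec R)" for x :: "real ^ 'm::{finite,linorder}"
      by (auto simp: mem_box_cart intro: order_trans)
    then show ?thesis using that[of 0] by auto
  qed
qed

text \<open>By Tonelli the integral is a product of integrals of \<open>t powr (k $ j - 1)\<close>
  over \<open>{0..R}\<close>, which are finite because the exponents exceed -1.\<close>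

lemma integrable_powr_prod_box:
  fixes k :: "real ^ 'm::finite"
  assumes k: "\<And>j. 0 < k $ j" and R: "0 \<le> R"
  shows "set_integrable lborel (cbox 0 (vec R)) (\<lambda>x. \<Prod>j\<in>UNIV. (x $ j) powr (k $ j - 1))"
proof -
  \<comment> \<open>Lebesgue measure on a Euclidean space factors over \<open>Basis\<close>, so the
    factors are indexed by basis vectors; \<open>k \<bullet> b\<close> is the component of
    \<open>k\<close> that belongs to \<open>b\<close>.\<close>
  define g :: "real ^ 'm \<Rightarrow> real \<Rightarrow> ennreal" where
    "g b t = ennreal (indicator {0..R} t * t powr (k \<bullet> b - 1))" for b t
  have g_meas: "g b \<in> borel_measurable borel" for b
    unfolding g_def[abs_def] by measurable
  have B: "(Basis :: (real ^ 'm) set) = range (\<lambda>i. axis i 1)"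
    by (auto simp: Basis_vec_def)
  have inj: "inj (\<lambda>i::'m. axis i (1::real))"
    by (auto simp: inj_on_def axis_eq_axis)
  have eq: "ennreal (norm (indicator (cbox 0 (vec R)) x *\<^sub>R (\<Prod>j\<in>UNIV. (x $ j) powr (k $ j - 1)))) =
      (\<Prod>b\<in>Basis. g b (x \<bullet> b))" for x :: "real ^ 'm"
  proof -
    have "indicator (cbox 0 (vec R)) x = (\<Prod>j\<in>UNIV. indicator {0..R} (x $ j) :: real)"
      by (auto simp: indicator_def mem_box_cart)
    then have "norm (indicator (cbox 0 (vec R)) x *\<^sub>R (\<Prod>j\<in>UNIV. (x $ j) powr (k $ j - 1))) =
        (\<Prod>j\<in>UNIV. indicator {0..R} (x $ j) * (x $ j) powr (k $ j - 1))"
      by (simp add: abs_mult abs_prod prod.distrib)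
    then show ?thesis
      by (simp add: B prod.reindex[OF inj] g_def prod_ennreal inner_axis)
  qed
  have "(\<integral>\<^sup>+t. g b t \<partial>lborel) < \<infinity>" if b: "b \<in> Basis" for b
  proof -
    obtain i where i: "b = axis i 1" using b unfolding B by blast
    have "(\<lambda>t. t powr (k $ i - 1)) integrable_on {0..R}"
      using k[of i] R by (intro integrable_on_powr_from_0) auto
    then obtain I where "((\<lambda>t. t powr (k $ i - 1)) has_integral I) {0..R}" by auto
    then have "(\<integral>\<^sup>+t. indicator {0..R} t * t powr (k $ i - 1) \<partial>lborel) = I"
      by (intro nn_integral_has_integral_lebesgue) auto
    then show ?thesis by (simp add: g_def i inner_axis)
  qed
  then have "(\<integral>\<^sup>+x. (\<Prod>b\<in>Basis. g b (x \<bullet> b)) \<partial>lborel) < \<infinity>"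
    using g_meas by (subst nn_integral_lborel_prod) (auto simp: less_top[symmetric] ennreal_prod_eq_top)
  then have "(\<integral>\<^sup>+x. ennreal (norm (indicator (cbox 0 (vec R)) x *\<^sub>R
      (\<Prod>j\<in>UNIV. (x $ j) powr (k $ j - 1)))) \<partial>lborel) < \<infinity>"
    unfolding eq .
  then show ?thesis
    unfolding set_integrable_def by (rule integrableI_bounded[rotated]) simp
qed

text \<open>All integrability claims about the density reduce to this one. The box \<open>?S\<close>
  contains every point of \<open>X_c\<close> with \<open>p x \<noteq> 0\<close>; on it
  \<open>p\<close> is bounded and \<open>mu_left\<close> is at most a constant times the integrable
  product of powers.\<close>

lemma set_integrable_mult_mu_left:
  fixes k :: "real ^ 'm::{finite,linorder}"
  assumes \<sigma>: "0 < \<sigma>" and lam: "0 < lam" and k: "\<And>j. 0 < k $ j"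
    and p: "continuous_on X_c p" and K: "bounded K" "\<And>x. x \<in> X_c - K \<Longrightarrow> p x = 0"
  shows "set_integrable lborel X_c (\<lambda>x. p x * mu_left \<sigma> k lam x)"
proof -
  obtain R where R: "0 < R" "\<And>x. x \<in> K \<Longrightarrow> norm x \<le> R"
    using K(1) by (auto simp: bounded_pos)
  let ?S = "cbox 0 (vec R) :: (real ^ 'm::{finite,linorder}) set"
  have SX: "?S \<subseteq> X_c" by (auto simp: X_c_def mem_box_cart)
  have KS: "x \<in> ?S" if x: "x \<in> X_c" "p x \<noteq> 0" for x
  proof -
    have "norm x \<le> R" using x K(2) R(2) by blast
    then have "x $ i \<le> R" for i using component_le_norm_cart[of x i] by linarith
    then show ?thesis using x by (auto simp: X_c_def mem_box_cart)
  qed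
  have "compact (p ` ?S)"
    using p SX by (intro compact_continuous_image) (auto intro: continuous_on_subset)
  then have "bounded (p ` ?S)" by (rule compact_imp_bounded)
  then obtain P where P: "0 < P" "\<And>x. x \<in> ?S \<Longrightarrow> \<bar>p x\<bar> \<le> P"
    unfolding bounded_pos by auto
  have "\<exists>C. 0 \<le> C \<and> (\<forall>x\<in>?S. mu_factor \<sigma> k lam j x \<le> C * (x $ j) powr (k $ j - 1))" for j
    using mu_factor_le[OF \<sigma> lam k] by metis
  then obtain C where C: "\<And>j. 0 \<le> C j"
    "\<And>j x. x \<in> ?S \<Longrightarrow> mu_factor \<sigma> k lam j x \<le> C j * (x $ j) powr (k $ j - 1)" by metis
  have mu: "mu_left \<sigma> k lam x \<le> prod C UNIV * (\<Prod>j\<in>UNIV. (x $ j) powr (k $ j - 1))" if "x \<in> ?S" for x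
    unfolding mu_left_eq_prod prod.distrib[symmetric]
    using that SX C mu_factor_nonneg[OF \<sigma> lam k] by (intro prod_mono) auto
  show ?thesis
    unfolding set_integrable_def
  proof (rule Bochner_Integration.integrable_bound)
    show "integrable lborel (\<lambda>x. P * prod C UNIV * (indicator ?S x *\<^sub>R (\<Prod>j\<in>UNIV. (x $ j) powr (k $ j - 1))))"
      using integrable_powr_prod_box[OF k, of R] R by (intro integrable_mult_right) (simp add: set_integrable_def)
    \<comment> \<open>Continuity of \<open>p\<close> is known only on \<open>X_c\<close>, so the
      indicator is attached to \<open>p\<close>.\<close>
    have "(\<lambda>x. (indicator X_c x *\<^sub>R p x) * mu_left \<sigma> k lam x) \<in> borel_measurable borel"
      using closed_X_c p by (intro borel_measurable_times borel_measurable_continuous_on_indicator) (auto intro: borel_closed)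
    then show "(\<lambda>x. indicator X_c x *\<^sub>R (p x * mu_left \<sigma> k lam x)) \<in> borel_measurable lborel"
      by (simp add: mult.assoc)
    have "norm (indicator X_c x *\<^sub>R (p x * mu_left \<sigma> k lam x)) \<le>
      norm (P * prod C UNIV * (indicator ?S x *\<^sub>R (\<Prod>j\<in>UNIV. (x $ j) powr (k $ j - 1))))" for x
    proof (cases "x \<in> X_c \<and> p x \<noteq> 0")
      case True
      then have x: "x \<in> ?S" using KS by auto
      have "\<bar>p x\<bar> * mu_left \<sigma> k lam x \<le> P * (prod C UNIV * (\<Prod>j\<in>UNIV. (x $ j) powr (k $ j - 1)))"
        using P(1) P(2)[OF x] mu[OF x] mu_left_nonneg[OF \<sigma> lam k] True by (intro mult_mono) auto
      then show ?thesis
        using True x mu_left_nonneg[OF \<sigma> lam k, of x] P(1) C(1)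
        by (simp add: abs_mult abs_prod mult.assoc)
    qed auto
    then show "AE x in lborel. norm (indicator X_c x *\<^sub>R (p x * mu_left \<sigma> k lam x)) \<le>
      norm (P * prod C UNIV * (indicator ?S x *\<^sub>R (\<Prod>j\<in>UNIV. (x $ j) powr (k $ j - 1))))" by simp
  qed
qed

section \<open>Exchange lines and the partial sums along them\<close>

lemma less_next_index: "j \<noteq> Max UNIV \<Longrightarrow> j < next_index j"
  and less_next_index_iff: "j \<noteq> Max UNIV \<Longrightarrow> i < next_index j \<longleftrightarrow> i \<le> j"
proof -
  assume "j \<noteq> Max UNIV"
  then have "j < Max UNIV" by (simp add: order_neq_le_trans)
  then have "next_index j \<in> {j<..}"
    unfolding next_index_def by (intro Min_in) auto
  then show j: "j < next_index j" by simp
  have "next_index j \<le> i" if "j < i" using that by (simp add: next_index_def)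
  then show "i < next_index j \<longleftrightarrow> i \<le> j"
    using j by (meson leD leI le_less_trans)
qed

lemma exchange_line_nth:
  assumes "j \<noteq> Max UNIV"
  shows "(x + s *\<^sub>R exchange_vec j) $ i =
    (if i = j then x $ i + s else if i = next_index j then x $ i - s else x $ i)"
  using less_next_index[OF assms] by (auto simp: axis_def)

text \<open>The gain at \<open>j\<close> and the loss at \<open>next_index j\<close> cancel in every
  partial sum that contains both; the only one that contains just the first is the sum up to
  \<open>j\<close>.\<close>

lemma E_left_exchange_line:
  assumes "j \<noteq> Max UNIV"
  shows "E_left (x + s *\<^sub>R exchange_vec j) i = E_left x i + (if i = j then s else 0)"
proof -
  have "E_left (x + s *\<^sub>R exchange_vec j) i =
      (\<Sum>l\<in>{..i}. x $ l + (if l = j then s else 0) - (if l = next_index j then s else 0))"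
    unfolding E_left_def
    using less_next_index[OF assms] by (intro sum.cong refl) (simp only: exchange_line_nth[OF assms], auto)
  also have "\<dots> = E_left x i + (if j \<le> i then s else 0) - (if next_index j \<le> i then s else 0)"
    by (simp add: E_left_def sum.distrib sum_subtractf)
  also have "\<dots> = E_left x i + (if i = j then s else 0)"
    using less_next_index_iff[OF assms, of i] by (auto simp: not_less)
  finally show ?thesis .
qed

lemma E_left_pred_exchange_line:
  assumes "j \<noteq> Max UNIV"
  shows "E_left_pred (x + s *\<^sub>R exchange_vec j) i =
    E_left_pred x i + (if i = next_index j then s else 0)"
  using E_left_exchange_line[OF assms, of x s i] exchange_line_nth[OF assms, of x s i]
    less_next_index[OF assms]
  by (auto simp: E_left_eq_pred split: if_splits)

lemma E_left_pred_next_index: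
  assumes "j \<noteq> Max UNIV"
  shows "E_left_pred x (next_index j) = E_left x j"
proof -
  have "{..<next_index j} = {..j}" using less_next_index_iff[OF assms] by auto
  then show ?thesis by (simp add: E_left_pred_def E_left_def)
qed

section \<open>Coefficients and density in terms of cosh levels\<close>

lemma sinh_mult_sinh: "sinh a * sinh b = (cosh (a + b) - cosh (b - a :: real)) / 2"
  by (simp add: cosh_add cosh_diff)

abbreviation cosh_level ::
    "real \<Rightarrow> real \<Rightarrow> real ^ ('m::{finite,linorder}) \<Rightarrow> 'm::{finite,linorder} \<Rightarrow> real" where
  "cosh_level \<sigma> lam x j \<equiv> cosh_scaled \<sigma> (lam + 2 * E_left x j)"

abbreviation cosh_level_pred ::
    "real \<Rightarrow> real \<Rightarrow> real ^ ('m::{finite,linorder}) \<Rightarrow> 'm::{finite,linorder} \<Rightarrow> real" where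
  "cosh_level_pred \<sigma> lam x j \<equiv> cosh_scaled \<sigma> (lam + 2 * E_left_pred x j)"

abbreviation sinh_level ::
    "real \<Rightarrow> real \<Rightarrow> real ^ ('m::{finite,linorder}) \<Rightarrow> 'm::{finite,linorder} \<Rightarrow> real" where
  "sinh_level \<sigma> lam x j \<equiv> sinh_scaled \<sigma> (lam + 2 * E_left x j)"

text \<open>In \<open>sinh_mult_sinh\<close> the two arguments add up to
  \<open>\<sigma> * (lam + 2 * E_left x j)\<close>, and their difference is the same expression with
  \<open>E_left_pred\<close>. The next lemma works likewise one index up.\<close>

lemma sinh_scaled_mult_pred:
  "sinh_scaled \<sigma> (x $ j) * sinh_scaled \<sigma> (lam + 2 * E_left x j - x $ j) =
    (cosh_level \<sigma> lam x j - cosh_level_pred \<sigma> lam x j) / 2"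
  by (simp add: sinh_scaled_def cosh_scaled_def sinh_mult_sinh E_left_eq_pred algebra_simps)

lemma sinh_scaled_mult_next:
  assumes "j \<noteq> Max UNIV"
  shows "sinh_scaled \<sigma> (x $ next_index j) * sinh_scaled \<sigma> (lam + 2 * E_left x j + x $ next_index j) =
    (cosh_level \<sigma> lam x (next_index j) - cosh_level \<sigma> lam x j) / 2"
  by (simp add: sinh_scaled_def cosh_scaled_def sinh_mult_sinh E_left_eq_pred[of x "next_index j"]
      E_left_pred_next_index[OF assms] algebra_simps)

lemma A_left_eq:
  assumes "j \<noteq> Max UNIV"
  shows "A_left \<sigma> lam j x = (cosh_level \<sigma> lam x j - cosh_level_pred \<sigma> lam x j) *
    (cosh_level \<sigma> lam x (next_index j) - cosh_level \<sigma> lam x j) / (4 * \<sigma>\<^sup>2 * (sinh_level \<sigma> lam x j)\<^sup>2)"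
proof -
  have "A_left \<sigma> lam j x = 1 / \<sigma>\<^sup>2 *
      (sinh_scaled \<sigma> (x $ j) * sinh_scaled \<sigma> (lam + 2 * E_left x j - x $ j)) *
      (sinh_scaled \<sigma> (x $ next_index j) * sinh_scaled \<sigma> (lam + 2 * E_left x j + x $ next_index j)) /
      (sinh_level \<sigma> lam x j)\<^sup>2"
    by (simp add: A_left_def Let_def)
  then show ?thesis
    unfolding sinh_scaled_mult_pred sinh_scaled_mult_next[OF assms] by simp
qed

lemma B_left_eq:
  assumes "j \<noteq> Max UNIV"
  shows "B_left \<sigma> k lam j x = 1 / \<sigma> *
    (k $ j * (cosh_level \<sigma> lam x (next_index j) - cosh_level \<sigma> lam x j) / (2 * sinh_level \<sigma> lam x j)
     - k $ next_index j * (cosh_level \<sigma> lam x j - cosh_level_pred \<sigma> lam x j) / (2 * sinh_level \<sigma> lam x j)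
     - cosh_level \<sigma> lam x j * (cosh_level \<sigma> lam x j - cosh_level_pred \<sigma> lam x j) *
       (cosh_level \<sigma> lam x (next_index j) - cosh_level \<sigma> lam x j) / (2 * sinh_level \<sigma> lam x j ^ 3))"
proof -
  have "B_left \<sigma> k lam j x = 1 / \<sigma> *
    (k $ j * (sinh_scaled \<sigma> (x $ next_index j) * sinh_scaled \<sigma> (lam + 2 * E_left x j + x $ next_index j))
        / sinh_level \<sigma> lam x j
     - k $ next_index j * (sinh_scaled \<sigma> (x $ j) * sinh_scaled \<sigma> (lam + 2 * E_left x j - x $ j))
        / sinh_level \<sigma> lam x j
     - 2 * cosh_level \<sigma> lam x j *
       (sinh_scaled \<sigma> (x $ j) * sinh_scaled \<sigma> (lam + 2 * E_left x j - x $ j)) *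
       (sinh_scaled \<sigma> (x $ next_index j) * sinh_scaled \<sigma> (lam + 2 * E_left x j + x $ next_index j))
        / sinh_level \<sigma> lam x j ^ 3)"
    by (simp add: B_left_def Let_def mult_ac)
  then show ?thesis
    unfolding sinh_scaled_mult_pred sinh_scaled_mult_next[OF assms] by simp
qed

text \<open>The part of \<open>mu_left\<close> that is constant along exchange lines in direction
  \<open>j\<close>. It contains the sinh factor of \<open>next_index j\<close>, because the partial
  sum up to there does not change.\<close>

definition mu_rest ::
    "real \<Rightarrow> real ^ ('m::{finite,linorder}) \<Rightarrow> real \<Rightarrow> 'm::{finite,linorder} \<Rightarrow>
      real ^ ('m::{finite,linorder}) \<Rightarrow> real" where
  "mu_rest \<sigma> k lam j x = sinh_level \<sigma> lam x (next_index j) /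
      ((\<sigma> powr (k $ j - 1) * Gamma (k $ j)) *
       (\<sigma> powr (k $ next_index j - 1) * Gamma (k $ next_index j))) *
      (\<Prod>i\<in>UNIV - {j, next_index j}. mu_factor \<sigma> k lam i x)"

lemma mu_left_eq_rest:
  assumes "j \<noteq> Max UNIV"
  shows "mu_left \<sigma> k lam x = mu_rest \<sigma> k lam j x * (sinh_level \<sigma> lam x j *
    (cosh_level \<sigma> lam x j - cosh_level_pred \<sigma> lam x j) powr (k $ j - 1) *
    (cosh_level \<sigma> lam x (next_index j) - cosh_level \<sigma> lam x j) powr (k $ next_index j - 1))"
proof -
  have "mu_left \<sigma> k lam x = mu_factor \<sigma> k lam j x * (mu_factor \<sigma> k lam (next_index j) x *
      (\<Prod>i\<in>UNIV - {j} - {next_index j}. mu_factor \<sigma> k lam i x))"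
    unfolding mu_left_eq_prod using less_next_index[OF assms]
    by (subst prod.remove[of UNIV j], simp, simp) (subst prod.remove[of "UNIV - {j}" "next_index j"], auto)
  moreover have "UNIV - {j} - {next_index j} = UNIV - {j, next_index j}" by auto
  ultimately show ?thesis
    by (simp add: mu_rest_def mu_factor_def[of _ _ _ j] mu_factor_def[of _ _ _ "next_index j"]
        E_left_pred_next_index[OF assms])
qed

lemma mu_rest_exchange_line:
  assumes "j \<noteq> Max UNIV"
  shows "mu_rest \<sigma> k lam j (x + s *\<^sub>R exchange_vec j) = mu_rest \<sigma> k lam j x"
proof -
  have "mu_factor \<sigma> k lam i (x + s *\<^sub>R exchange_vec j) = mu_factor \<sigma> k lam i x"
    if "i \<in> UNIV - {j, next_index j}" for i
    using that unfolding mu_factor_def E_left_exchange_line[OF assms] E_left_pred_exchange_line[OF assms]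
    by simp
  moreover have "j \<noteq> next_index j" using less_next_index[OF assms] by simp
  ultimately show ?thesis
    unfolding mu_rest_def E_left_exchange_line[OF assms] by simp
qed

section \<open>The flux and its derivative along exchange lines\<close>

text \<open>The identity D_j (A_j mu) = B_j mu on one line, without the constant
  \<open>mu_rest\<close>: \<open>c\<close> and \<open>S\<close> are the cosh and sinh levels at
  \<open>j\<close>, \<open>a\<close> and \<open>b\<close> the neighbouring cosh levels,
  \<open>p\<close> and \<open>q\<close> the entries of \<open>k\<close>. Differentiating the two
  powers and the factor \<open>1 / S s\<close> yields the three terms of \<open>B_left_eq\<close> in
  this order.\<close>

lemma has_real_derivative_beta_weight:
  fixes c S :: "real \<Rightarrow> real"
  assumes c: "(c has_real_derivative 2 * \<sigma> * S s) (at s)"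
    and S: "(S has_real_derivative 2 * \<sigma> * c s) (at s)"
    and pos: "a < c s" "c s < b" and nz: "S s \<noteq> 0" "\<sigma> \<noteq> 0"
  shows "((\<lambda>s. (c s - a) powr p * (b - c s) powr q / (4 * \<sigma>\<^sup>2 * S s)) has_real_derivative
    1 / \<sigma> * (p * (b - c s) / (2 * S s) - q * (c s - a) / (2 * S s)
      - c s * (c s - a) * (b - c s) / (2 * S s ^ 3)) *
    (S s * (c s - a) powr (p - 1) * (b - c s) powr (q - 1))) (at s)"
proof -
  \<comment> \<open>Once all powers are written through the lowered ones \<open>P\<close> and
    \<open>Q\<close>, the claim is an identity of rational functions.\<close>
  define P Q where "P = (c s - a) powr (p - 1)" and "Q = (b - c s) powr (q - 1)"
  have P: "(c s - a) powr p = (c s - a) * P" and Q: "(b - c s) powr q = (b - c s) * Q"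
    using pos powr_mult_base[of "c s - a" "p - 1"] powr_mult_base[of "b - c s" "q - 1"]
    by (simp_all add: P_def Q_def)
  have dP: "((\<lambda>s. (c s - a) powr p) has_real_derivative p * P * (2 * \<sigma> * S s)) (at s)"
    unfolding P_def using pos
    by (intro DERIV_chain2[where f = "\<lambda>z. z powr p"] has_real_derivative_powr)
       (auto intro!: derivative_eq_intros c)
  have dQ: "((\<lambda>s. (b - c s) powr q) has_real_derivative q * Q * (- (2 * \<sigma> * S s))) (at s)"
    unfolding Q_def using pos
    by (intro DERIV_chain2[where f = "\<lambda>z. z powr q"] has_real_derivative_powr)
       (auto intro!: derivative_eq_intros c)
  have "((\<lambda>s. (c s - a) powr p * (b - c s) powr q / (4 * \<sigma>\<^sup>2 * S s)) has_real_derivative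
     ((p * P * (2 * \<sigma> * S s) * ((b - c s) * Q) + (q * Q * (- (2 * \<sigma> * S s))) * ((c s - a) * P)) *
       (4 * \<sigma>\<^sup>2 * S s) - (c s - a) * P * ((b - c s) * Q) * (4 * \<sigma>\<^sup>2 * (2 * \<sigma> * c s))) /
      ((4 * \<sigma>\<^sup>2 * S s) * (4 * \<sigma>\<^sup>2 * S s))) (at s)"
    using DERIV_divide[OF DERIV_mult[OF dP dQ] DERIV_cmult[OF S, of "4 * \<sigma>\<^sup>2"]] nz
    unfolding P Q by simp
  moreover have "((p * P * (2 * \<sigma> * S s) * ((b - c s) * Q) + (q * Q * (- (2 * \<sigma> * S s))) * ((c s - a) * P)) *
       (4 * \<sigma>\<^sup>2 * S s) - (c s - a) * P * ((b - c s) * Q) * (4 * \<sigma>\<^sup>2 * (2 * \<sigma> * c s))) /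
      ((4 * \<sigma>\<^sup>2 * S s) * (4 * \<sigma>\<^sup>2 * S s)) =
     1 / \<sigma> * (p * (b - c s) / (2 * S s) - q * (c s - a) / (2 * S s)
      - c s * (c s - a) * (b - c s) / (2 * S s ^ 3)) * (S s * P * Q)"
    using nz by (simp add: divide_simps) (simp add: algebra_simps power2_eq_square power3_eq_cube power4_eq_xxxx)
  ultimately show ?thesis by (simp add: P_def Q_def)
qed

text \<open>The two differences in \<open>A_left_eq\<close> raise both exponents by 1, and its
  squared sinh turns the factor \<open>sinh_level\<close> of the density into a denominator.\<close>

lemma A_left_mult_mu_left_eq:
  assumes j: "j \<noteq> Max UNIV" and x: "x \<in> X_c" and "0 < \<sigma>" "0 < lam"
  shows "A_left \<sigma> lam j x * mu_left \<sigma> k lam x = mu_rest \<sigma> k lam j x *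
    ((cosh_level \<sigma> lam x j - cosh_level_pred \<sigma> lam x j) powr (k $ j) *
     (cosh_level \<sigma> lam x (next_index j) - cosh_level \<sigma> lam x j) powr (k $ next_index j)
      / (4 * \<sigma>\<^sup>2 * sinh_level \<sigma> lam x j))"
proof -
  \<comment> \<open>At \<open>t = 0\<close> both sides are 0 whatever \<open>p\<close> is, so the
    formula also holds on the faces of the orthant, where the exchange lines end.\<close>
  have base: "t * t powr (p - 1) = t powr p" if "0 \<le> t" for t p :: real
    using powr_mult_base[OF that, of "p - 1"] by simp
  have mono: "cosh (\<sigma> * (lam + 2 * s)) \<le> cosh (\<sigma> * (lam + 2 * t))" if "0 \<le> s" "s \<le> t" for s t
    using that assms by (intro cosh_real_nonneg_le_iff[THEN iffD2]) (auto intro: mult_left_mono)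
  have "0 \<le> cosh_level \<sigma> lam x j - cosh_level_pred \<sigma> lam x j"
    using mono[of "E_left_pred x j" "E_left x j"] E_left_pred_nonneg[OF x, of j] x
    by (auto simp: cosh_scaled_def E_left_eq_pred X_c_def)
  note P = base[OF this, of "k $ j"]
  have "0 \<le> cosh_level \<sigma> lam x (next_index j) - cosh_level \<sigma> lam x j"
    using mono[of "E_left x j" "E_left x (next_index j)"] E_left_nonneg[OF x, of j] x
    by (auto simp: cosh_scaled_def E_left_eq_pred[of x "next_index j"] E_left_pred_next_index[OF j] X_c_def)
  note Q = base[OF this, of "k $ next_index j"]
  show ?thesis
    unfolding A_left_eq[OF j] mu_left_eq_rest[OF j] P[symmetric] Q[symmetric]
    using sinh_scaled_E_left_neq_0[OF assms(3,4) x, of j] assms(3)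
    by (simp add: divide_simps power2_eq_square) 
qed

lemma continuous_on_cutoff:
  fixes f :: "real \<Rightarrow> real"
  assumes "a \<le> b" "continuous_on {a..b} f" "f a = 0" "f b = 0"
  shows "continuous_on UNIV (\<lambda>s. if s \<in> {a..b} then f s else 0)"
proof -
  have "continuous_on ({a..b} \<union> ({..a} \<union> {b..})) (\<lambda>s. if s \<in> {a..b} then f s else 0)"
    using assms by (intro continuous_on_cases) (auto simp: antisym)
  moreover have "{a..b} \<union> ({..a} \<union> {b..}) = UNIV" by auto
  ultimately show ?thesis by simp
qed

text \<open>Only two coordinates move, in opposite directions, and their signs bound
  \<open>s\<close> on either side. The point \<open>x\<close> need not lie in \<open>X_c\<close>,
  since the integral runs over the whole space; hence the case \<open>outside\<close>. The segment
  may be a single point.\<close>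

lemma exchange_line_cases:
  fixes x :: "real ^ ('m::{finite,linorder})"
  assumes j: "j \<noteq> Max UNIV"
  obtains (outside) "\<And>s. x + s *\<^sub>R exchange_vec j \<notin> X_c"
  | (inside) "- (x $ j) \<le> x $ next_index j"
      "\<And>s. x + s *\<^sub>R exchange_vec j \<in> X_c \<longleftrightarrow> s \<in> {- (x $ j)..x $ next_index j}"
proof (cases "\<exists>s. x + s *\<^sub>R exchange_vec j \<in> X_c")
  case True
  then obtain s where s: "\<And>i. 0 \<le> (x + s *\<^sub>R exchange_vec j) $ i" by (auto simp: X_c_def)
  have n: "next_index j \<noteq> j" using less_next_index[OF j] by simp
  have le: "- (x $ j) \<le> s" "s \<le> x $ next_index j"
    using s[of j] s[of "next_index j"] n unfolding exchange_line_nth[OF j] by auto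
  have other: "0 \<le> x $ i" if "i \<noteq> j" "i \<noteq> next_index j" for i
    using s[of i] that unfolding exchange_line_nth[OF j] by simp
  have iff: "x + t *\<^sub>R exchange_vec j \<in> X_c \<longleftrightarrow> t \<in> {- (x $ j)..x $ next_index j}" for t
  proof
    assume "x + t *\<^sub>R exchange_vec j \<in> X_c"
    then have "0 \<le> (x + t *\<^sub>R exchange_vec j) $ i" for i by (simp only: X_c_def mem_Collect_eq)
    from this[of j] this[of "next_index j"] show "t \<in> {- (x $ j)..x $ next_index j}"
      using n unfolding exchange_line_nth[OF j] by auto
  next
    assume "t \<in> {- (x $ j)..x $ next_index j}"
    then show "x + t *\<^sub>R exchange_vec j \<in> X_c"
      using other unfolding X_c_def mem_Collect_eq exchange_line_nth[OF j] by auto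
  qed
  show ?thesis
    by (rule inside[OF order_trans[OF le] iff])
qed (use outside in blast)

text \<open>The flux \<open>A_left * mu_left * h\<close> vanishes at both ends of an exchange line because it carries
  the exponents \<open>k $ j\<close> and \<open>k $ next_index j\<close>, which are positive, in place of those lowered by 1.\<close>

lemma flux_along_exchange_line:
  fixes x k :: "real ^ ('m::{finite,linorder})"
  assumes \<sigma>: "0 < \<sigma>" and lam: "0 < lam" and k: "\<And>i. 0 < k $ i" and j: "j \<noteq> Max UNIV"
    and h: "h differentiable_on X_c"
  defines "F \<equiv> \<lambda>x. indicator X_c x * (A_left \<sigma> lam j x * mu_left \<sigma> k lam x * h x)"
    and "G \<equiv> \<lambda>x. indicator X_c x *
      ((A_left \<sigma> lam j x * D_exchange j h x + B_left \<sigma> k lam j x * h x) * mu_left \<sigma> k lam x)"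
  shows "continuous_on UNIV (\<lambda>s. F (x + s *\<^sub>R exchange_vec j)) \<and>
    (\<exists>S. finite S \<and> (\<forall>s. s \<notin> S \<longrightarrow>
      ((\<lambda>s. F (x + s *\<^sub>R exchange_vec j)) has_real_derivative G (x + s *\<^sub>R exchange_vec j)) (at s)))"
proof -
  consider (outside) "\<And>s. x + s *\<^sub>R exchange_vec j \<notin> X_c"
    | (inside) "- (x $ j) \<le> x $ next_index j"
      "\<And>s. x + s *\<^sub>R exchange_vec j \<in> X_c \<longleftrightarrow> s \<in> {- (x $ j)..x $ next_index j}"
    using exchange_line_cases[OF j, of x] by metis
  then show ?thesis
  proof cases
    case outside
    then have "F (x + s *\<^sub>R exchange_vec j) = 0" "G (x + s *\<^sub>R exchange_vec j) = 0" for s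
      by (simp_all add: F_def G_def)
    then show ?thesis by (auto intro!: exI[of _ "{}"])
  next
    case inside
    let ?l = "\<lambda>s. x + s *\<^sub>R exchange_vec j"
    let ?\<alpha> = "- (x $ j)" and ?\<beta> = "x $ next_index j"
    have n: "next_index j \<noteq> j" "j \<noteq> next_index j" using less_next_index[OF j] by auto
    define K where "K = mu_rest \<sigma> k lam j x"
    define u where "u s = lam + 2 * (E_left x j + s)" for s
    define c where "c s = cosh (\<sigma> * u s)" for s
    define S where "S s = sinh (\<sigma> * u s)" for s
    define a b where "a = cosh_level_pred \<sigma> lam x j" and "b = cosh_level \<sigma> lam x (next_index j)"
    define W where "W s = (c s - a) powr (k $ j) * (b - c s) powr (k $ next_index j) / (4 * \<sigma>\<^sup>2 * S s)" for s
    have levels: "cosh_level \<sigma> lam (?l s) j = c s" "sinh_level \<sigma> lam (?l s) j = S s"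
      "cosh_level_pred \<sigma> lam (?l s) j = a" "cosh_level \<sigma> lam (?l s) (next_index j) = b" for s
      using n unfolding E_left_exchange_line[OF j] E_left_pred_exchange_line[OF j]
      by (simp_all add: c_def S_def u_def a_def b_def cosh_scaled_def sinh_scaled_def)
    have F_line: "F (?l s) = (if s \<in> {?\<alpha>..?\<beta>} then K * W s * h (?l s) else 0)" for s
      using A_left_mult_mu_left_eq[OF j _ \<sigma> lam, of "?l s" k] inside(2)[of s]
      unfolding levels mu_rest_exchange_line[OF j] by (auto simp: F_def K_def W_def)
    \<comment> \<open>At \<open>s = - (x $ j)\<close> coordinate \<open>j\<close> is 0, so the level
      at \<open>j\<close> meets the one below; at \<open>s = x $ next_index j\<close> the next
      coordinate is 0 and it meets the one above.\<close>
    have a_eq: "a = c ?\<alpha>" and b_eq: "b = c ?\<beta>"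
      by (simp_all add: a_def b_def c_def u_def cosh_scaled_def E_left_eq_pred[of x j]
          E_left_eq_pred[of x "next_index j"] E_left_pred_next_index[OF j, unfolded E_left_eq_pred[of x j]])
    have S_pos: "0 < S s" if "s \<in> {?\<alpha>..?\<beta>}" for s
      using sinh_scaled_E_left_pos[OF \<sigma> lam, of "?l s" j] that inside(2)[of s] unfolding levels by simp
    have u_pos: "0 < u s" if "s \<in> {?\<alpha>..?\<beta>}" for s
      using S_pos[OF that] \<sigma> by (simp add: S_def zero_less_mult_iff)
    have c_mono: "c s < c t" if "s \<in> {?\<alpha>..?\<beta>}" "s < t" for s t
      using that u_pos[of s] \<sigma> unfolding c_def
      by (intro cosh_real_nonneg_less_iff[THEN iffD2]) (auto simp: u_def)
    have c_bounds: "a \<le> c s" "c s \<le> b" if "s \<in> {?\<alpha>..?\<beta>}" for s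
      using that c_mono[of ?\<alpha> s] c_mono[of s ?\<beta>] unfolding a_eq b_eq by (auto simp: order_le_less)
    have c_deriv: "(c has_real_derivative 2 * \<sigma> * S s) (at s)" for s
      unfolding c_def S_def u_def by (auto intro!: derivative_eq_intros)
    have S_deriv: "(S has_real_derivative 2 * \<sigma> * c s) (at s)" for s
      unfolding c_def S_def u_def by (auto intro!: derivative_eq_intros)
    have cont_l: "continuous_on {?\<alpha>..?\<beta>} (\<lambda>s. h (?l s))"
    proof (rule continuous_on_compose2[OF differentiable_imp_continuous_on[OF h]])
      show "continuous_on {?\<alpha>..?\<beta>} ?l"
        by (intro continuous_intros)
      show "?l ` {?\<alpha>..?\<beta>} \<subseteq> X_c"
        by (rule image_subsetI) (rule inside(2)[THEN iffD2])
    qed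
    have "continuous_on {?\<alpha>..?\<beta>} c" "continuous_on {?\<alpha>..?\<beta>} S"
      unfolding c_def S_def u_def by (intro continuous_intros)+
    \<comment> \<open>The bases \<open>c s - a\<close> and \<open>b - c s\<close> reach 0 at the
      ends, where \<open>powr\<close> is continuous because the entries of \<open>k\<close> are
      positive.\<close>
    then have cont: "continuous_on {?\<alpha>..?\<beta>} (\<lambda>s. K * W s * h (?l s))"
      unfolding W_def using c_bounds S_pos \<sigma> k
      by (intro continuous_on_mult continuous_on_divide continuous_on_diff continuous_on_const cont_l
          continuous_on_powr') (auto dest: S_pos[THEN less_imp_neq])
    have "continuous_on UNIV (\<lambda>s. F (?l s))"
      unfolding F_line by (rule continuous_on_cutoff[OF inside(1) cont]) (simp_all add: W_def a_eq b_eq)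
    \<comment> \<open>The ends are excluded: there the flux may have a corner or, for an entry of
      \<open>k\<close> below 1, a vertical tangent. Inside the segment the product rule applies;
      outside it \<open>F\<close> and \<open>G\<close> are 0.\<close>
    moreover have "((\<lambda>s. F (?l s)) has_real_derivative G (?l s)) (at s)" if s: "s \<notin> {?\<alpha>, ?\<beta>}" for s
    proof (cases "s \<in> {?\<alpha><..<?\<beta>}")
      case True
      then have s': "s \<in> {?\<alpha>..?\<beta>}" "?l s \<in> X_c" using inside(2)[of s] by auto
      have "a < c s" "c s < b"
        using True inside(1) c_mono[of ?\<alpha> s] c_mono[of s ?\<beta>] by (auto simp: a_eq b_eq)
      then have "(W has_real_derivative 1 / \<sigma> * (k $ j * (b - c s) / (2 * S s)
        - k $ next_index j * (c s - a) / (2 * S s) - c s * (c s - a) * (b - c s) / (2 * S s ^ 3)) *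
        (S s * (c s - a) powr (k $ j - 1) * (b - c s) powr (k $ next_index j - 1))) (at s)"
        unfolding W_def[abs_def] using S_pos[OF s'(1)] \<sigma>
        by (intro has_real_derivative_beta_weight c_deriv S_deriv) auto
      then have KW: "((\<lambda>s. K * W s) has_real_derivative
          B_left \<sigma> k lam j (?l s) * mu_left \<sigma> k lam (?l s)) (at s)"
        unfolding B_left_eq[OF j] mu_left_eq_rest[OF j] levels mu_rest_exchange_line[OF j] K_def
        by (auto intro!: derivative_eq_intros)
      have h': "((\<lambda>s. h (?l s)) has_real_derivative D_exchange j h (?l s)) (at s)"
        using True inside(2) by (intro has_real_derivative_along_exchange[OF h, of ?\<alpha> s ?\<beta>]) auto
      have "K * W s = A_left \<sigma> lam j (?l s) * mu_left \<sigma> k lam (?l s)"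
        using A_left_mult_mu_left_eq[OF j s'(2) \<sigma> lam, of k]
        unfolding levels mu_rest_exchange_line[OF j] by (simp add: K_def W_def)
      then have "((\<lambda>s. K * W s * h (?l s)) has_real_derivative G (?l s)) (at s)"
        using DERIV_mult[OF KW h'] s'(2) by (simp add: G_def algebra_simps)
      then show ?thesis
        by (rule has_field_derivative_transform_within_open[OF _ open_greaterThanLessThan True])
           (simp add: F_line)
    next
      case False
      then have s': "s \<in> - {?\<alpha>..?\<beta>}" using s by auto
      then have "G (?l s) = 0" using inside(2)[of s] by (simp add: G_def)
      then have "((\<lambda>s. 0) has_real_derivative G (?l s)) (at s)" by simp
      then show ?thesis
        by (rule has_field_derivative_transform_within_open[OF _ _ s']) (auto simp: F_line)
    qed
    ultimately show ?thesis by (intro conjI exI[of _ "{?\<alpha>, ?\<beta>}"]) auto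
  qed
qed

section \<open>Symmetry of the generator\<close>

text \<open>This is \<open>integral_directional_derivative_eq_0\<close> for
  \<open>v = exchange_vec j\<close> and the flux extended by 0 outside \<open>X_c\<close>. Only one
  derivative of \<open>h\<close> is demanded, because \<open>h\<close> will already contain first
  derivatives of the C2 test functions.\<close>

lemma exchange_integral_eq_0:
  fixes k :: "real ^ ('m::{finite,linorder})"
  assumes \<sigma>: "0 < \<sigma>" and lam: "0 < lam" and k: "\<And>i. 0 < k $ i" and j: "j \<noteq> Max UNIV"
    and h: "h differentiable_on X_c" "continuous_on X_c (D_exchange j h)"
    and K: "compact K" "\<And>x. x \<in> X_c - K \<Longrightarrow> h x = 0"
  shows "set_integrable lborel X_c (\<lambda>x.
      (A_left \<sigma> lam j x * D_exchange j h x + B_left \<sigma> k lam j x * h x) * mu_left \<sigma> k lam x)" (is ?int)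
    and "(LINT x:X_c|lborel.
      (A_left \<sigma> lam j x * D_exchange j h x + B_left \<sigma> k lam j x * h x) * mu_left \<sigma> k lam x) = 0"
proof -
  note cont = continuous_on_A_left[OF \<sigma> lam] continuous_on_B_left[OF \<sigma> lam]
    differentiable_imp_continuous_on[OF h(1)] h(2)
  have bK: "bounded K" "closed K" using K(1) by (auto simp: compact_imp_bounded compact_imp_closed)
  have D0: "D_exchange j h x = 0" if "x \<in> X_c - K" for x
    using D_exchange_eq_0[of x K h j] bK(2) K(2) that by blast
  have "continuous_on X_c (\<lambda>x. A_left \<sigma> lam j x * D_exchange j h x + B_left \<sigma> k lam j x * h x)"
    by (intro continuous_on_add continuous_on_mult cont)
  then show int: ?int
    by (rule set_integrable_mult_mu_left[OF \<sigma> lam k _ bK(1)]) (simp add: D0 K(2))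
  have "continuous_on X_c (\<lambda>x. A_left \<sigma> lam j x * h x)"
    by (intro continuous_on_mult cont)
  then have intF: "set_integrable lborel X_c (\<lambda>x. A_left \<sigma> lam j x * h x * mu_left \<sigma> k lam x)"
    by (rule set_integrable_mult_mu_left[OF \<sigma> lam k _ bK(1)]) (simp add: K(2))
  have line: "continuous_on {0..1} (\<lambda>s. indicator X_c (x + s *\<^sub>R exchange_vec j) *
       (A_left \<sigma> lam j (x + s *\<^sub>R exchange_vec j) * mu_left \<sigma> k lam (x + s *\<^sub>R exchange_vec j) *
        h (x + s *\<^sub>R exchange_vec j)))" for x
    using flux_along_exchange_line[OF \<sigma> lam k j h(1), of x] continuous_on_subset by blast
  show "(LINT x:X_c|lborel.
      (A_left \<sigma> lam j x * D_exchange j h x + B_left \<sigma> k lam j x * h x) * mu_left \<sigma> k lam x) = 0"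
    unfolding set_lebesgue_integral_def real_scaleR_def
  proof (rule integral_directional_derivative_eq_0[OF _ _ line])
    show "integrable lborel (\<lambda>x. indicator X_c x * (A_left \<sigma> lam j x * mu_left \<sigma> k lam x * h x))"
      using intF by (simp add: set_integrable_def mult_ac)
    show "integrable lborel (\<lambda>x. indicator X_c x * ((A_left \<sigma> lam j x * D_exchange j h x +
        B_left \<sigma> k lam j x * h x) * mu_left \<sigma> k lam x))"
      using int by (simp add: set_integrable_def)
  qed (rule flux_along_exchange_line[OF \<sigma> lam k j h(1), THEN conjunct2])
qed

text \<open>Used with \<open>f' = D_exchange j f\<close> and \<open>g' = D_exchange j g\<close>: the
  mixed products of first derivatives cancel and only second-order terms remain.\<close>

lemma D_exchange_mult_diff:
  assumes "x \<in> X_c" "f differentiable (at x within X_c)" "g differentiable (at x within X_c)"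
    "f' differentiable (at x within X_c)" "g' differentiable (at x within X_c)"
  shows "D_exchange j (\<lambda>x. f' x * g x - f x * g' x) x =
    (D_exchange j f' x * g x + f' x * D_exchange j g x) -
    (D_exchange j f x * g' x + f x * D_exchange j g' x)"
proof -
  obtain F G F' G' where D: "(f has_derivative F) (at x within X_c)" "(g has_derivative G) (at x within X_c)"
    "(f' has_derivative F') (at x within X_c)" "(g' has_derivative G') (at x within X_c)"
    using assms by (auto simp: differentiable_def)
  show ?thesis
    unfolding D_exchange_eqI[OF assms(1) has_derivative_diff[OF has_derivative_mult[OF D(3,2)]
          has_derivative_mult[OF D(1,4)]]]
      D_exchange_eqI[OF assms(1) D(1)] D_exchange_eqI[OF assms(1) D(2)]
      D_exchange_eqI[OF assms(1) D(3)] D_exchange_eqI[OF assms(1) D(4)]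
    by simp
qed

lemma C1_imp_continuous_on: "C1 f \<Longrightarrow> continuous_on X_c f"
  by (simp add: C1_def differentiable_imp_continuous_on)

lemma C2_imp_C1: "C2 f \<Longrightarrow> C1 f"
  by (simp add: C2_def)

lemma C2_compact_support_vanishes:
  assumes "f \<in> C2_compact_support"
  shows "\<exists>K. compact K \<and> (\<forall>x\<in>X_c - K. f x = 0)"
proof (intro exI conjI ballI)
  show "compact (closure {x \<in> X_c. f x \<noteq> 0})"
    using assms by (simp add: C2_compact_support_def)
  show "f x = 0" if "x \<in> X_c - closure {x \<in> X_c. f x \<noteq> 0}" for x
    using that closure_subset[of "{x \<in> X_c. f x \<noteq> 0}"] by auto
qed

lemma continuous_on_L_ABEP_left:
  assumes "0 < \<sigma>" "0 < lam" "C2 f"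
  shows "continuous_on X_c (L_ABEP_left \<sigma> k lam f)"
  unfolding L_ABEP_left_def[abs_def]
  by (intro continuous_on_sum continuous_on_add continuous_on_mult
      continuous_on_A_left[OF assms(1,2)] continuous_on_B_left[OF assms(1,2)]
      continuous_on_D_exchange C1_D_exchange[OF assms(3)] C2_imp_C1[OF assms(3)])

theorem theorem4p11:
  fixes \<sigma> lam :: real and k :: "real ^ 'm::{finite,linorder}"
  assumes "\<sigma> > 0" and "lam > 0" and "\<And>j. k $ j > 0"
  shows "reversible_density (L_ABEP_left \<sigma> k lam) (mu_left \<sigma> k lam)"
  unfolding reversible_density_def
proof (intro conjI ballI)
  show "set_borel_measurable lborel X_c (mu_left \<sigma> k lam)"
    unfolding set_borel_measurable_def using borel_closed[OF closed_X_c] by measurable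
  show "0 \<le> mu_left \<sigma> k lam x" if "x \<in> X_c" for x
    using mu_left_nonneg[OF assms that] .
next
  fix f g :: "real ^ 'm::{finite,linorder} \<Rightarrow> real"
  assume f: "f \<in> C2_compact_support" and g: "g \<in> C2_compact_support"
  define L where "L = (L_ABEP_left \<sigma> k lam :: (real ^ 'm::{finite,linorder} \<Rightarrow> real) \<Rightarrow> _)"
  define m where "m = mu_left \<sigma> k lam"
  have C2: "C2 f" "C2 g" using f g by (auto simp: C2_compact_support_def)
  then have C1: "C1 f" "C1 g" by (auto intro: C2_imp_C1)
  obtain K where K: "compact K" "\<And>x. x \<in> X_c - K \<Longrightarrow> f x = 0"
    using C2_compact_support_vanishes[OF f] by blast
  obtain K' where K': "compact K'" "\<And>x. x \<in> X_c - K' \<Longrightarrow> g x = 0"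
    using C2_compact_support_vanishes[OF g] by blast
  \<comment> \<open>The undifferentiated factor alone confines each integrand to a bounded set:
    \<open>K'\<close> from \<open>g\<close> here, \<open>K\<close> from \<open>f\<close> for the
    other one.\<close>
  have "continuous_on X_c (\<lambda>x. L_ABEP_left \<sigma> k lam f x * g x)"
    by (intro continuous_on_mult continuous_on_L_ABEP_left C1[THEN C1_imp_continuous_on] C2 assms(1,2))
  then show I1: "set_integrable lborel X_c (\<lambda>x. L_ABEP_left \<sigma> k lam f x * g x * mu_left \<sigma> k lam x)"
    by (rule set_integrable_mult_mu_left[OF assms _ compact_imp_bounded[OF K'(1)]]) (simp add: K'(2))
  have "continuous_on X_c (\<lambda>x. f x * L_ABEP_left \<sigma> k lam g x)"
    by (intro continuous_on_mult continuous_on_L_ABEP_left C1[THEN C1_imp_continuous_on] C2 assms(1,2))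
  then show I2: "set_integrable lborel X_c (\<lambda>x. f x * L_ABEP_left \<sigma> k lam g x * mu_left \<sigma> k lam x)"
    by (rule set_integrable_mult_mu_left[OF assms _ compact_imp_bounded[OF K(1)]]) (simp add: K(2))
  define h where "h j x = D_exchange j f x * g x - f x * D_exchange j g x" for j x
  define I where "I j x = (A_left \<sigma> lam j x * D_exchange j (h j) x + B_left \<sigma> k lam j x * h j x) * m x" for j x
  have Dh: "D_exchange j (h j) x = D_exchange j (D_exchange j f) x * g x - f x * D_exchange j (D_exchange j g) x"
    if "x \<in> X_c" for j x
    using D_exchange_mult_diff[OF that, of f g "D_exchange j f" "D_exchange j g" j]
      C1 C1_D_exchange[OF C2(1), of j] C1_D_exchange[OF C2(2), of j] that
    by (simp add: h_def[abs_def] C1_def differentiable_on_def)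
  have h_diff: "h j differentiable_on X_c" for j
    using C1 C1_D_exchange[OF C2(1), of j] C1_D_exchange[OF C2(2), of j]
    unfolding h_def[abs_def] C1_def
    by (intro differentiable_on_diff differentiable_on_mult) auto
  have "continuous_on X_c (\<lambda>x. D_exchange j (D_exchange j f) x * g x - f x * D_exchange j (D_exchange j g) x)" for j
    by (intro continuous_on_diff continuous_on_mult continuous_on_D_exchange
        C1_D_exchange[OF C2(1)] C1_D_exchange[OF C2(2)] C1[THEN C1_imp_continuous_on])
  \<comment> \<open>Continuity is read off the formula \<open>Dh\<close>, whose right-hand side
    involves only \<open>f\<close>, \<open>g\<close> and first derivatives of C1 functions.\<close>
  then have h_cont: "continuous_on X_c (D_exchange j (h j))" for j
    by (subst continuous_on_cong[OF refl Dh])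
  \<comment> \<open>Off \<open>K\<close> both \<open>f\<close> and, as \<open>K\<close> is closed,
    \<open>D_exchange j f\<close> are 0, which removes both products in \<open>h\<close>.\<close>
  have h0: "h j x = 0" if "x \<in> X_c - K" for j x
  proof -
    have "D_exchange j f x = 0"
      using that by (intro D_exchange_eq_0[OF _ compact_imp_closed[OF K(1)] _ K(2)]) auto
    then show ?thesis using K(2)[OF that] by (simp add: h_def)
  qed
  have I: "set_integrable lborel X_c (I j)" "(LINT x:X_c|lborel. I j x) = 0" if "j \<noteq> Max UNIV" for j
    using exchange_integral_eq_0[OF assms that h_diff h_cont K(1) h0]
    by (simp_all add: I_def[abs_def] m_def)
  have "(LINT x:X_c|lborel. L f x * g x * m x) - (LINT x:X_c|lborel. f x * L g x * m x) =
      (LINT x:X_c|lborel. L f x * g x * m x - f x * L g x * m x)"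
    using I1 I2 by (simp add: L_def m_def)
  \<comment> \<open>By \<open>Dh\<close> the summands for \<open>j\<close> differ by
    \<open>A_left\<close> times \<open>D_exchange j (h j)\<close> plus \<open>B_left\<close> times
    \<open>h j\<close>, all times the density.\<close>
  also have "\<dots> = (LINT x:X_c|lborel. \<Sum>j | j \<noteq> Max UNIV. I j x)"
  proof (intro set_lebesgue_integral_cong allI impI)
    fix x :: "real ^ 'm::{finite,linorder}" assume "x \<in> X_c"
    then show "L f x * g x * m x - f x * L g x * m x = (\<Sum>j | j \<noteq> Max UNIV. I j x)"
      unfolding L_def L_ABEP_left_def I_def sum_distrib_left sum_distrib_right sum_subtractf[symmetric]
      by (intro sum.cong refl) (simp add: Dh h_def algebra_simps)
  qed (use closed_X_c borel_closed in auto)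
  also have "\<dots> = (\<Sum>j | j \<noteq> Max UNIV. LINT x:X_c|lborel. I j x)"
    unfolding set_lebesgue_integral_def scaleR_sum_right
    using I(1) by (intro Bochner_Integration.integral_sum) (simp add: set_integrable_def)
  also have "\<dots> = 0" using I(2) by simp
  finally show "(LINT x:X_c|lborel. L_ABEP_left \<sigma> k lam f x * g x * mu_left \<sigma> k lam x) =
      (LINT x:X_c|lborel. f x * L_ABEP_left \<sigma> k lam g x * mu_left \<sigma> k lam x)"
    by (simp add: L_def m_def)
qed

end
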